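(* For every even integer $m\geq 50$, the line graph $L(K_{m,m})$ of the complete bipartite graph $K_{m,m}$ has the PMH--property, i.e. every perfect matching of $L(K_{m,m})$ is contained in some hamiltonian cycle of $L(K_{m,m})$.
   Context: The line graph $L(G)$ has vertex set $E(G)$, two vertices being adjacent when the corresponding edges of $G$ share an end-vertex. A graph has the PMH--property if each of its perfect matchings can be extended to a hamiltonian cycle. *)

theory Defs
  imports Main
begin

text \<open>A graph is a pair of a vertex set and a set of edges; an edge is a two-element set of vertices.\<close>

type_synonym 'a graph = "'a set \<times> 'a set set"

abbreviation verts :: "'a graph \<Rightarrow> 'a set" where
  "verts G \<equiv> fst G"

abbreviation edges :: "'a graph \<Rightarrow> 'a set set" where
  "edges G \<equiv> snd G"

definition simple_graph :: "'a graph \<Rightarrow> bool" where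
  "simple_graph G \<longleftrightarrow> finite (verts G) \<and> (\<forall>e \<in> edges G. e \<subseteq> verts G \<and> card e = 2)"

definition complete_bipartite :: "nat \<Rightarrow> nat \<Rightarrow> (nat + nat) graph" where
  "complete_bipartite m n =
     (Inl ` {..<m} \<union> Inr ` {..<n}, {{Inl i, Inr j} | i j. i < m \<and> j < n})"

definition line_graph :: "'a graph \<Rightarrow> 'a set graph" where
  "line_graph G =
     (edges G, {{e, f} | e f. e \<in> edges G \<and> f \<in> edges G \<and> e \<noteq> f \<and> e \<inter> f \<noteq> {}})"

definition perfect_matching :: "'a graph \<Rightarrow> 'a set set \<Rightarrow> bool" where
  "perfect_matching G M \<longleftrightarrow> M \<subseteq> edges G \<and> (\<forall>v \<in> verts G. \<exists>!e. e \<in> M \<and> v \<in> e)"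

text \<open>A cycle is given by the list of its vertices in cyclic order, the first vertex not being
  repeated at the end.\<close>

definition cycle_edges :: "'a list \<Rightarrow> 'a set set" where
  "cycle_edges vs = {{vs ! i, vs ! (Suc i mod length vs)} | i. i < length vs}"

definition hamiltonian_cycle :: "'a graph \<Rightarrow> 'a list \<Rightarrow> bool" where
  "hamiltonian_cycle G vs \<longleftrightarrow>
     length vs \<ge> 3 \<and> distinct vs \<and> set vs = verts G \<and> cycle_edges vs \<subseteq> edges G"

definition PMH_property :: "'a graph \<Rightarrow> bool" where
  "PMH_property G \<longleftrightarrow>
     (\<forall>M. perfect_matching G M \<longrightarrow> (\<exists>vs. hamiltonian_cycle G vs \<and> M \<subseteq> cycle_edges vs))"

lemma simple_graph_complete_bipartite: "simple_graph (complete_bipartite m n)"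
  unfolding simple_graph_def complete_bipartite_def by auto

lemma simple_graph_line_graph:
  assumes "simple_graph G"
  shows "simple_graph (line_graph G)"
proof -
  have "edges G \<subseteq> Pow (verts G)"
    using assms unfolding simple_graph_def by auto
  then have "finite (edges G)"
    using assms finite_subset unfolding simple_graph_def by blast
  then show ?thesis
    unfolding simple_graph_def line_graph_def by (auto simp: card_2_iff)
qed

end

(* A Hamiltonian cycle of the line graph through M is an Euler tour in disguise. If every edge e of G
   is labelled with one of its ends, each pair {e, f} of M becomes an edge, between the labels of e
   and f, of a multigraph on the vertices of G; an Euler tour of it lists the pairs of M so that
   consecutive pairs meet in a vertex. The labels can be chosen to make the multigraph connected with
   even degrees once G has two connected spanning subgraphs T and Q such that T contains at most one
   edge of every pair and Q none of the edges of the pairs met by T. Random T and Q have this property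
   with positive probability: a vertex set X with |X| <= m has at least |X| m / 2 edges of K_{m,m}
   leaving it, and each of T and Q misses all of them with probability at most (3/4)^(|X| m / 2). *)
theory Submission
  imports Defs Complex_Main "HOL-Library.FuncSet"
begin

section \<open>Connectedness by cuts, and correction of parities\<close>

definition cut :: "'a set set \<Rightarrow> 'a set \<Rightarrow> 'a set set" where
  "cut E X = {e \<in> E. e \<inter> X \<noteq> {} \<and> \<not> e \<subseteq> X}"

text \<open>Connectedness is stated by cuts rather than paths because the random choice delivers it
  in this form, and the parity and Euler arguments apply it to a vertex set closed under some
  operation.\<close>

definition cut_connected :: "'a set \<Rightarrow> 'a set set \<Rightarrow> bool" where
  "cut_connected V E \<longleftrightarrow> (\<forall>X \<subseteq> V. X \<noteq> {} \<longrightarrow> X \<noteq> V \<longrightarrow> cut E X \<noteq> {})"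

text \<open>Adding modulo 2 the edges of a path in \<open>Q\<close> leaves the pair of its two ends,
  so \<open>F\<close> is closed under symmetric difference with any pair of vertices; pairs then
  exhaust a set of even size. In the application \<open>F\<close> consists of the sets of odd-degree
  vertices that relabelling can produce, and the empty set is an Eulerian labelling.\<close>

lemma parity_adjustment:
  assumes "finite V" and conn: "cut_connected V Q"
    and Q: "\<And>e. e \<in> Q \<Longrightarrow> e \<subseteq> V \<and> card e = 2"
    and F: "\<And>S. S \<in> F \<Longrightarrow> S \<subseteq> V"
    and flip: "\<And>S e. S \<in> F \<Longrightarrow> e \<in> Q \<Longrightarrow> sym_diff S e \<in> F"
    and S: "S \<in> F" "even (card S)"
  shows "{} \<in> F"
proof -
  have pair: "sym_diff S (sym_diff {x} {y}) \<in> F" if "S \<in> F" "x \<in> V" "y \<in> V" for S x y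
  proof -
    \<comment> \<open>\<open>sym_diff {x} {y}\<close> is empty for \<open>y = x\<close>, which puts
      \<open>x\<close> into \<open>X\<close>. The quantifier over all of \<open>F\<close> lets the
      set be shifted by \<open>e\<close> before the pair of \<open>x\<close> and \<open>a\<close> is
      applied; \<open>a\<close> then cancels.\<close>
    define X where "X = {y \<in> V. \<forall>S \<in> F. sym_diff S (sym_diff {x} {y}) \<in> F}"
    have "x \<in> X" using \<open>x \<in> V\<close> by (auto simp: X_def)
    have "X = V"
    proof (rule ccontr)
      assume "X \<noteq> V"
      moreover have "X \<subseteq> V" by (auto simp: X_def)
      ultimately obtain e where "e \<in> cut Q X"
        using conn \<open>x \<in> X\<close> unfolding cut_connected_def by blast
      then obtain a b where e: "e \<in> Q" "a \<in> e" "a \<in> X" "b \<in> e" "b \<notin> X"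
        unfolding cut_def by blast
      then have "a \<noteq> b" by auto
      then have eab: "e = {a, b}" using Q[OF e(1)] e by (auto simp: card_2_iff)
      have "sym_diff S (sym_diff {x} {b}) \<in> F" if "S \<in> F" for S
      proof -
        have "sym_diff (sym_diff S e) (sym_diff {x} {a}) \<in> F"
          using flip[OF that e(1)] e(3) by (auto simp: X_def)
        also have "sym_diff (sym_diff S e) (sym_diff {x} {a}) = sym_diff S (sym_diff {x} {b})"
          using \<open>a \<noteq> b\<close> by (auto simp: eab)
        finally show ?thesis .
      qed
      moreover have "b \<in> V" using Q[OF e(1)] e by auto
      ultimately show False using e(5) by (simp add: X_def)
    qed
    then show ?thesis using that by (auto simp: X_def)
  qed
  show ?thesis
    using S
  proof (induction "card S" arbitrary: S rule: less_induct)
    case less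
    have fin: "finite S" using F[OF less.prems(1)] \<open>finite V\<close> finite_subset by blast
    show ?case
    proof (cases "S = {}")
      case False
      then obtain x where x: "x \<in> S" by auto
      then have "S \<noteq> {x}" using less.prems(2) by auto
      then obtain y where y: "y \<in> S" "y \<noteq> x" using x by auto
      have "sym_diff S (sym_diff {x} {y}) = S - {x, y}" using x y by auto
      then have "S - {x, y} \<in> F"
        using pair[OF less.prems(1), of x y] x y F[OF less.prems(1)] by auto
      moreover have "card S = card (S - {x, y}) + 2"
        using x y fin card_Diff_subset[of "{x, y}" S] card_mono[of S "{x, y}"] by simp
      ultimately show ?thesis using less.hyps[of "S - {x, y}"] less.prems(2) by auto
    qed (use less.prems in simp)
  qed
qed

section \<open>Euler trails\<close>

text \<open>Read each \<open>e\<close> of the list as an edge from \<open>l e\<close> to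
  \<open>l (mu e)\<close>. Where one edge ends the next begins, so inner passages through
  \<open>v\<close> count twice and only the two ends of the trail decide the parity.\<close>

lemma even_length_filter_trail:
  assumes "es \<noteq> []" and "successively (\<lambda>e f. l (mu e) = l f) es"
  shows "even (length (filter (\<lambda>e. l e = v) (es @ map mu es)))
           \<longleftrightarrow> (l (hd es) = v \<longleftrightarrow> l (mu (last es)) = v)"
  using assms
proof (induction es rule: list_nonempty_induct)
  case (single x)
  then show ?case by auto
next
  case (cons x xs)
  then have "l (mu x) = l (hd xs)" by (simp add: successively_Cons)
  with cons show ?case by (auto simp: successively_Cons)
qed

text \<open>Hierholzer's argument: a longest trail is closed by parity, and it uses every edge because
  otherwise it could be rotated and prolonged.\<close>

lemma closed_euler_trail:
  assumes "finite C" and "C \<noteq> {}"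
    and mu: "\<And>e. e \<in> C \<Longrightarrow> mu e \<in> C \<and> mu e \<noteq> e \<and> mu (mu e) = e"
    and even: "\<And>v. even (card {e \<in> C. l e = v})"
    and conn: "\<And>D. D \<subseteq> C \<Longrightarrow> D \<noteq> {} \<Longrightarrow> D \<noteq> C \<Longrightarrow> mu ` D \<subseteq> D \<Longrightarrow>
                 \<exists>e \<in> D. \<exists>f \<in> C - D. l e = l f"
  obtains es where "es \<noteq> []" "distinct (es @ map mu es)" "set (es @ map mu es) = C"
    "successively (\<lambda>e f. l (mu e) = l f) es" "l (mu (last es)) = l (hd es)"
proof -
  define trail where "trail es \<longleftrightarrow> es \<noteq> [] \<and> distinct (es @ map mu es) \<and> set es \<subseteq> C \<and>
      successively (\<lambda>e f. l (mu e) = l f) es" for es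
  obtain c where c: "c \<in> C" using \<open>C \<noteq> {}\<close> by auto
  have "trail [c]" using c mu[OF c] by (auto simp: trail_def)
  moreover have "length es \<le> card C" if "trail es" for es
  proof -
    have "length es = card (set es)" using that by (simp add: trail_def distinct_card)
    then show ?thesis using that \<open>finite C\<close> by (simp add: trail_def card_mono)
  qed
  ultimately obtain es where es: "trail es" and longest: "\<And>fs. trail fs \<Longrightarrow> length fs \<le> length es"
    using ex_has_greatest_nat[of trail "[c]" length "card C"] by (metis le_eq_less_or_eq not_less)
  define D where "D = set (es @ map mu es)"
  have esC: "set es \<subseteq> C" and dist: "distinct (es @ map mu es)" and ne: "es \<noteq> []"
    and succ: "successively (\<lambda>e f. l (mu e) = l f) es"
    using es by (auto simp: trail_def)
  have "D \<subseteq> C" using esC mu by (auto simp: D_def)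
  have muD: "mu ` D \<subseteq> D" using esC mu by (auto simp: D_def)
  \<comment> \<open>Maximality is stated for every trail with the same set of edges as
    \<open>es\<close>, so that it also serves for the rotation below.\<close>
  have extend: False
    if "trail fs" "set fs = set es" "length fs = length es" "f \<in> C - D" "l (mu (last fs)) = l f"
    for fs f
  proof -
    have D': "D = set (fs @ map mu fs)" using that(2) by (simp add: D_def)
    have "mu f \<notin> D" using muD mu[of f] that(4) by (metis DiffD1 DiffD2 image_subset_iff)
    then have "trail (fs @ [f])"
      using that mu[of f] unfolding trail_def D'
      by (auto simp: successively_append_iff)
    then show False using longest[of "fs @ [f]"] that(3) by simp
  qed
  have closed: "l (mu (last es)) = l (hd es)"
  proof (rule ccontr)
    assume neq: "l (mu (last es)) \<noteq> l (hd es)"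
    let ?v = "l (mu (last es))"
    have "{e \<in> D. l e = ?v} = set (filter (\<lambda>e. l e = ?v) (es @ map mu es))"
      by (auto simp: D_def)
    also have "card \<dots> = length (filter (\<lambda>e. l e = ?v) (es @ map mu es))"
      using dist by (intro distinct_card distinct_filter)
    finally have "odd (card {e \<in> D. l e = ?v})"
      using even_length_filter_trail[OF ne succ, of ?v] neq by auto
    then have "{e \<in> D. l e = ?v} \<noteq> {e \<in> C. l e = ?v}" using even[of ?v] by metis
    then obtain f where "f \<in> C - D" "l f = ?v" using \<open>D \<subseteq> C\<close> by auto
    then show False using extend[OF es refl refl] by metis
  qed
  have "D = C"
  proof (rule ccontr)
    assume "D \<noteq> C"
    moreover have "D \<noteq> {}" using ne by (auto simp: D_def)
    ultimately obtain e f where ef: "e \<in> D" "f \<in> C - D" "l e = l f"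
      using conn[OF \<open>D \<subseteq> C\<close> _ _ muD] by blast
    \<comment> \<open>If \<open>e\<close> is the second end of a trail edge, the next trail edge
      starts at the same vertex; after the last edge this is the first one, as the trail is
      closed.\<close>
    have "\<exists>g \<in> set es. l g = l e"
    proof (cases "e \<in> set es")
      case False
      then obtain i where i: "i < length es" "e = mu (es ! i)"
        using ef(1) by (auto simp: D_def in_set_conv_nth)
      show ?thesis
      proof (cases "Suc i < length es")
        case True
        then have "l e = l (es ! Suc i)"
          using succ i by (simp add: successively_conv_nth)
        then show ?thesis using True nth_mem by metis
      next
        case False
        then have "es ! i = last es" using i ne
          by (metis last_conv_nth Suc_lessI diff_Suc_1)
        then show ?thesis using closed i ne by (metis hd_in_set)
      qed
    qed auto
    then obtain xs g ys where g: "es = xs @ g # ys" "l g = l e"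
      by (metis split_list)
    \<comment> \<open>The rotation starts at \<open>l e\<close>, hence ends there too, and can be
      prolonged by \<open>f\<close>.\<close>
    let ?fs = "g # ys @ xs"
    have "successively (\<lambda>e f. l (mu e) = l f) ?fs"
      using succ closed by (cases "xs = []"; cases "ys = []")
        (simp_all add: g(1) successively_append_iff successively_Cons)
    then have "trail ?fs"
      using dist esC unfolding trail_def g(1) by auto
    moreover have "l (mu (last ?fs)) = l f"
      using succ closed g ef(3) by (cases xs rule: rev_cases)
        (auto simp: successively_append_iff)
    ultimately show False using extend[of ?fs f] ef(2) g(1) by auto
  qed
  then show ?thesis using that es closed by (auto simp: trail_def D_def)
qed

section \<open>From perfect matchings and trails to Hamiltonian cycles\<close>

text \<open>This turns the matching into a fixed-point-free involution on the edges of
  \<open>G\<close>. It is an involution because a matching pair is determined by either of its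
  members.\<close>

lemma perfect_matching_partner:
  assumes "simple_graph G" and M: "perfect_matching (line_graph G) M"
  obtains mu where
    "\<forall>e \<in> edges G. mu e \<in> edges G \<and> mu e \<noteq> e \<and> mu (mu e) = e \<and> e \<inter> mu e \<noteq> {}"
    "M = (\<lambda>e. {e, mu e}) ` edges G"
proof -
  have uniq: "\<exists>!p. p \<in> M \<and> e \<in> p" if "e \<in> edges G" for e
    using M that by (auto simp: perfect_matching_def line_graph_def)
  have pair: "\<exists>e f. p = {e, f} \<and> e \<in> edges G \<and> f \<in> edges G \<and> e \<noteq> f \<and> e \<inter> f \<noteq> {}"
    if "p \<in> M" for p
    using M that by (auto simp: perfect_matching_def line_graph_def)
  have "\<exists>f. {e, f} \<in> M \<and> f \<in> edges G \<and> e \<noteq> f \<and> e \<inter> f \<noteq> {}"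
    if e: "e \<in> edges G" for e
  proof -
    obtain p where p: "p \<in> M" "e \<in> p" using uniq[OF e] by auto
    obtain a b where ab: "p = {a, b}" "a \<in> edges G" "b \<in> edges G" "a \<noteq> b" "a \<inter> b \<noteq> {}"
      using pair[OF p(1)] by blast
    show ?thesis
    proof (cases "e = a")
      case True
      then show ?thesis using ab p by blast
    next
      case False
      then have "e = b" using ab p by auto
      then show ?thesis using ab p by (intro exI[of _ a]) (auto simp: insert_commute)
    qed
  qed
  then obtain mu where mu: "\<And>e. e \<in> edges G \<Longrightarrow>
      {e, mu e} \<in> M \<and> mu e \<in> edges G \<and> e \<noteq> mu e \<and> e \<inter> mu e \<noteq> {}"
    by metis
  have same: "p = {e, mu e}" if "p \<in> M" "e \<in> p" "e \<in> edges G" for p e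
    using uniq[OF that(3)] mu[OF that(3)] that by blast
  have inv: "mu (mu e) = e" if "e \<in> edges G" for e
  proof -
    have "{e, mu e} = {mu e, mu (mu e)}" using mu[OF that] by (intro same) auto
    then show ?thesis using mu[OF that] by (auto simp: doubleton_eq_iff)
  qed
  have "M = (\<lambda>e. {e, mu e}) ` edges G"
  proof
    show "M \<subseteq> (\<lambda>e. {e, mu e}) ` edges G"
    proof
      fix p assume "p \<in> M"
      then obtain a where "a \<in> p" "a \<in> edges G" using pair by blast
      then show "p \<in> (\<lambda>e. {e, mu e}) ` edges G" using same \<open>p \<in> M\<close> by blast
    qed
  qed (use mu in auto)
  then show ?thesis using that mu inv by metis
qed

lemma nth_concat_pairs:
  assumes "i < length es"
  shows "concat (map (\<lambda>e. [e, mu e]) es) ! (2 * i) = es ! i"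
    "concat (map (\<lambda>e. [e, mu e]) es) ! Suc (2 * i) = mu (es ! i)"
  using assms by (induction es arbitrary: i) (auto simp: nth_Cons split: nat.splits)

text \<open>The cycle is e1, mu e1, e2, mu e2, and so on. Members of a matching pair meet by
  assumption; \<open>mu\<close> of one trail edge meets the next trail edge in their common label,
  and closedness of the trail supplies the last adjacency.\<close>

lemma hamiltonian_cycle_of_trail:
  assumes "card (edges G) \<ge> 3"
    and mu: "\<And>e. e \<in> edges G \<Longrightarrow> mu e \<in> edges G \<and> mu e \<noteq> e \<and> mu (mu e) = e \<and> e \<inter> mu e \<noteq> {}"
    and l: "\<And>e. e \<in> edges G \<Longrightarrow> l e \<in> e"
    and es: "distinct (es @ map mu es)" "set (es @ map mu es) = edges G"
      "successively (\<lambda>e f. l (mu e) = l f) es" "l (mu (last es)) = l (hd es)"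
  obtains vs where "hamiltonian_cycle (line_graph G) vs"
    "(\<lambda>e. {e, mu e}) ` edges G \<subseteq> cycle_edges vs"
proof -
  define vs where "vs = concat (map (\<lambda>e. [e, mu e]) es)"
  have len: "length vs = 2 * length es" by (simp add: vs_def length_concat sum_list_triv o_def)
  have set_vs: "set vs = edges G" unfolding es(2)[symmetric] by (auto simp: vs_def)
  have "card (edges G) = length (es @ map mu es)"
    using es(1) unfolding es(2)[symmetric] by (intro distinct_card)
  then have card: "card (edges G) = length vs" by (simp add: len)
  then have "distinct vs" using set_vs by (simp add: card_distinct)
  have len3: "length vs \<ge> 3" using card assms(1) by simp
  note nth = nth_concat_pairs[of _ es mu, folded vs_def]
  have meet: "vs ! i \<inter> vs ! (Suc i mod length vs) \<noteq> {}" if "i < length vs" for i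
  proof (cases "even i")
    case True
    then obtain k where k: "i = 2 * k" by auto
    have "k < length es" "Suc i < length vs" using that k len by auto
    moreover from this have "es ! k \<in> edges G" by (auto simp flip: es(2))
    ultimately show ?thesis using nth[of k] mu by (simp add: k)
  next
    case False
    then obtain k where k: "i = Suc (2 * k)" by (auto elim: oddE)
    have kl: "k < length es" using that k len by auto
    \<comment> \<open>The cyclic successor of \<open>k\<close>.\<close>
    define j where "j = (if Suc k < length es then Suc k else 0)"
    have j: "j < length es" "vs ! (Suc i mod length vs) = es ! j"
    proof -
      show j: "j < length es" using kl by (auto simp: j_def)
      have "Suc i mod length vs = 2 * j"
        using kl len by (auto simp: j_def k not_less le_Suc_eq)
      then show "vs ! (Suc i mod length vs) = es ! j" using nth[OF j] by simp
    qed
    have "l (mu (es ! k)) = l (es ! j)"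
    proof (cases "Suc k < length es")
      case True
      then show ?thesis using successively_nth[OF es(3)] by (simp add: j_def)
    next
      case False
      then have "k = length es - 1" using kl by simp
      moreover have "es \<noteq> []" using kl by auto
      ultimately show ?thesis using es(4) False by (simp add: j_def last_conv_nth hd_conv_nth)
    qed
    moreover have "es ! k \<in> edges G" "es ! j \<in> edges G" using kl j by (auto simp flip: es(2))
    ultimately have "l (es ! j) \<in> mu (es ! k) \<inter> es ! j" using l mu by (metis IntI)
    then show ?thesis using nth[OF kl] j by (auto simp: k)
  qed
  have "cycle_edges vs \<subseteq> edges (line_graph G)"
  proof
    fix p assume "p \<in> cycle_edges vs"
    then obtain i where i: "i < length vs" "p = {vs ! i, vs ! (Suc i mod length vs)}"
      by (auto simp: cycle_edges_def)
    have "Suc i mod length vs < length vs" using i(1) by (intro mod_less_divisor) auto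
    moreover have "Suc i mod length vs \<noteq> i"
      using i(1) len3 by (cases "Suc i = length vs") auto
    ultimately have "vs ! i \<noteq> vs ! (Suc i mod length vs)" "vs ! i \<in> edges G"
      "vs ! (Suc i mod length vs) \<in> edges G"
      using \<open>distinct vs\<close> i(1) set_vs nth_mem by (auto simp: nth_eq_iff_index_eq)
    then show "p \<in> edges (line_graph G)"
      using meet[OF i(1)] i(2) by (auto simp: line_graph_def)
  qed
  then have "hamiltonian_cycle (line_graph G) vs"
    using \<open>distinct vs\<close> set_vs len3 by (simp add: hamiltonian_cycle_def line_graph_def)
  moreover have "{e, mu e} \<in> cycle_edges vs" if e: "e \<in> edges G" for e
  proof -
    have main: "{e, mu e} \<in> cycle_edges vs" if e: "e \<in> set es" for e
    proof -
      obtain k where k: "k < length es" "e = es ! k" using e by (auto simp: in_set_conv_nth)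
      then have "{e, mu e} = {vs ! (2 * k), vs ! (Suc (2 * k) mod length vs)}" "2 * k < length vs"
        using nth[OF k(1)] len by auto
      then show ?thesis unfolding cycle_edges_def by blast
    qed
    show ?thesis
    proof (cases "e \<in> set es")
      case False
      then obtain f where f: "f \<in> set es" "e = mu f" using e by (auto simp flip: es(2))
      then have "mu e = f" using mu[of f] by (auto simp flip: es(2))
      then show ?thesis using main[OF f(1)] f(2) by (simp add: insert_commute)
    qed (rule main)
  qed
  ultimately show ?thesis using that by blast
qed

text \<open>The chosen end l e of an edge e is where the cycle passes from e to an edge of another matching
  pair. For e in T the ends chosen for e and mu e are the two ends of e, so that the multigraph with
  an edge from l e to l (mu e) for every pair contains T and is connected; the choices on Q are then
  corrected to make its degrees even.\<close>

lemma hamiltonian_cycle_of_connected_pair: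
  assumes G: "simple_graph G" and "even (card (edges G))" and "card (edges G) \<ge> 3"
    and mu: "\<And>e. e \<in> edges G \<Longrightarrow> mu e \<in> edges G \<and> mu e \<noteq> e \<and> mu (mu e) = e \<and> e \<inter> mu e \<noteq> {}"
    and T: "T \<subseteq> edges G" "T \<inter> mu ` T = {}" "cut_connected (verts G) T"
    and Q: "Q \<subseteq> edges G" "Q \<inter> (T \<union> mu ` T) = {}" "cut_connected (verts G) Q"
  obtains vs where "hamiltonian_cycle (line_graph G) vs"
    "(\<lambda>e. {e, mu e}) ` edges G \<subseteq> cycle_edges vs"
proof -
  have "finite (verts G)" and E: "\<And>e. e \<in> edges G \<Longrightarrow> e \<subseteq> verts G \<and> card e = 2"
    using G by (auto simp: simple_graph_def)
  moreover have "edges G \<subseteq> Pow (verts G)" using E by auto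
  ultimately have "finite (edges G)" by (meson finite_Pow_iff finite_subset)
  have two: "\<exists>w \<in> e. w \<noteq> v" if "e \<in> edges G" for e v
    using E[OF that] by (auto simp: card_2_iff)
  \<comment> \<open>The choice depends only on the set \<open>e \<inter> mu e\<close>, so
    \<open>e\<close> and \<open>mu e\<close> receive the same vertex.\<close>
  define s where "s e = (SOME v. v \<in> e \<inter> mu e)" for e
  define l0 where "l0 e = (if e \<in> T then SOME v. v \<in> e \<and> v \<noteq> s e else s e)" for e
  have s: "s e \<in> e \<inter> mu e" "s (mu e) = s e" if "e \<in> edges G" for e
  proof -
    show "s e \<in> e \<inter> mu e" 
      using someI_ex[of "\<lambda>v. v \<in> e \<inter> mu e"] mu[OF that] unfolding s_def by blast
    show "s (mu e) = s e" using mu[OF that] by (simp add: s_def Int_commute)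
  qed
  have l0_T: "l0 e \<in> e \<and> l0 e \<noteq> s e" if "e \<in> T" for e
    using someI_ex[of "\<lambda>v. v \<in> e \<and> v \<noteq> s e"] two[of e "s e"] that T(1) by (auto simp: l0_def)
  define L where "L = {l. (\<forall>e \<in> edges G. l e \<in> e) \<and> (\<forall>e. e \<notin> Q \<longrightarrow> l e = l0 e)}"
  define odds where "odds l = {v \<in> verts G. odd (card {e \<in> edges G. l e = v})}" for l
  have "l0 \<in> L" 
  proof -
    have "l0 e \<in> e" if "e \<in> edges G" for e
      using s(1)[OF that] l0_T[of e] by (cases "e \<in> T") (auto simp: l0_def)
    then show ?thesis by (simp add: L_def)
  qed
  \<comment> \<open>Moving the label of \<open>e\<close> to its other end changes the parity at both
    ends of \<open>e\<close> and nowhere else.\<close>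
  have flip: "sym_diff (odds l) e \<in> odds ` L" if l: "l \<in> L" and e: "e \<in> Q" for l e
  proof -
    have eG: "e \<in> edges G" using e Q(1) by auto
    obtain w where w: "w \<in> e" "w \<noteq> l e" using two[OF eG] by blast
    have "l e \<in> e" using l eG by (auto simp: L_def)
    then have ew: "e = {l e, w}" using E[OF eG] w by (auto simp: card_2_iff)
    let ?l = "l(e := w)"
    have "?l \<in> L" using l e w by (auto simp: L_def)
    moreover have "odds ?l = sym_diff (odds l) e"
    proof -
      have "odd (card {f \<in> edges G. ?l f = v}) \<longleftrightarrow> (odd (card {f \<in> edges G. l f = v}) \<noteq> (v \<in> e))"
        for v
      proof -
        let ?A = "{f \<in> edges G. l f = v} - {e}"
        have fin: "finite ?A" using \<open>finite (edges G)\<close> by simp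
        consider "v = w" | "v = l e" | "v \<notin> e" using ew by auto
        then show ?thesis
        proof cases
          case 1
          then have "{f \<in> edges G. ?l f = v} = insert e ?A" "{f \<in> edges G. l f = v} = ?A"
            using eG w by auto
          then show ?thesis using 1 w fin by (metis (no_types, lifting) DiffD2 card_insert_disjoint
              even_Suc insertI1)
        next
          case 2
          then have "{f \<in> edges G. ?l f = v} = ?A" "{f \<in> edges G. l f = v} = insert e ?A"
            using eG w by auto
          then show ?thesis using 2 \<open>l e \<in> e\<close> fin by (metis (no_types, lifting) DiffD2
              card_insert_disjoint even_Suc insertI1)
        next
          case 3
          then have "{f \<in> edges G. ?l f = v} = {f \<in> edges G. l f = v}"
            using w \<open>l e \<in> e\<close> by auto
          then show ?thesis using 3 by simp
        qed
      qed
      then show ?thesis using E[OF eG] unfolding odds_def by blast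
    qed
    ultimately show ?thesis by (metis image_eqI)
  qed
  \<comment> \<open>Every edge of \<open>G\<close> carries one label, so the degrees sum to the even
    number \<open>card (edges G)\<close>.\<close>
  have "even (card (odds l0))"
  proof -
    have "card (edges G) = (\<Sum>v \<in> verts G. card {e \<in> edges G. l0 e = v})"
    proof -
      have "l0 ` edges G \<subseteq> verts G" using \<open>l0 \<in> L\<close> E by (force simp: L_def)
      then have "(\<Sum>v \<in> verts G. \<Sum>e \<in> {e \<in> edges G. l0 e = v}. 1) = (\<Sum>e \<in> edges G. 1::nat)"
        using \<open>finite (verts G)\<close> \<open>finite (edges G)\<close> by (intro sum.group)
      then show ?thesis by simp
    qed
    then show ?thesis
      using \<open>even (card (edges G))\<close> \<open>finite (verts G)\<close> by (simp add: odds_def even_sum_iff)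
  qed
  have "{} \<in> odds ` L"
  proof (rule parity_adjustment[OF \<open>finite (verts G)\<close> Q(3)])
    show "odds l0 \<in> odds ` L" using \<open>l0 \<in> L\<close> by (rule imageI)
    show "S \<subseteq> verts G" if "S \<in> odds ` L" for S using that by (auto simp: odds_def)
  qed (use E Q(1) flip \<open>even (card (odds l0))\<close> in auto)
  then obtain l where l: "l \<in> L" and "odds l = {}" by auto
  have le: "l e \<in> e" if "e \<in> edges G" for e using l that by (auto simp: L_def)
  have even: "even (card {e \<in> edges G. l e = v})" for v
  proof (cases "v \<in> verts G")
    case True
    then show ?thesis using \<open>odds l = {}\<close> by (auto simp: odds_def)
  next
    case False
    then have "{e \<in> edges G. l e = v} = {}" using le E by blast
    then show ?thesis by (simp only: card.empty even_zero)
  qed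
  \<comment> \<open>Neither \<open>e\<close> nor \<open>mu e\<close> lies in \<open>Q\<close>, so
    the correction has left both labels alone; \<open>mu e\<close> is outside \<open>T\<close> and
    keeps the common vertex, while \<open>e\<close> has the other end.\<close>
  have tree: "e = {l e, l (mu e)}" if "e \<in> T" for e
  proof -
    have eG: "e \<in> edges G" using that T(1) by auto
    have "e \<notin> Q" "mu e \<notin> Q" "mu e \<notin> T" using that Q(2) T(2) by auto
    then have "l e = l0 e" "l (mu e) = s e"
      using l s(2)[OF eG] by (auto simp: L_def l0_def)
    then show ?thesis using l0_T[OF that] s(1)[OF eG] E[OF eG] by (auto simp: card_2_iff)
  qed
  \<comment> \<open>If the labels of \<open>D\<close> cover all vertices, any edge outside
    \<open>D\<close> shares one of them. Otherwise some \<open>e\<close> in \<open>T\<close> leaves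
    \<open>l\<close> D\<open>; its ends are the labels of\<close>e\<open>and\<close>mu
    e\<open>, which lie both in\<close>D\<open>or both outside. The former would keep\<close>e\<open>within\<close>l
    \<open>D\<close>, and the latter gives the shared label.\<close>
  have conn: "\<exists>e \<in> D. \<exists>f \<in> edges G - D. l e = l f"
    if D: "D \<subseteq> edges G" "D \<noteq> {}" "D \<noteq> edges G" "mu ` D \<subseteq> D" for D
  proof (rule ccontr)
    assume no: "\<not> ?thesis"
    have "l ` D \<subseteq> verts G" using D(1) le E by blast
    moreover have "l ` D \<noteq> verts G"
    proof
      assume eq: "l ` D = verts G"
      obtain f where f: "f \<in> edges G - D" using D by auto
      then have "l f \<in> verts G" using le[of f] E[of f] by auto
      then obtain e where "e \<in> D" "l f = l e" unfolding eq[symmetric] by auto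
      then show False using no f by metis
    qed
    ultimately obtain e where "e \<in> cut T (l ` D)"
      using T(3) D(2) unfolding cut_connected_def by blast
    then have e: "e \<in> T" "e \<inter> l ` D \<noteq> {}" "\<not> e \<subseteq> l ` D" by (auto simp: cut_def)
    have eG: "e \<in> edges G" "mu e \<in> edges G" using e(1) T(1) mu by auto
    have "mu e \<in> D \<longleftrightarrow> e \<in> D"
      using D(4) mu[OF eG(1)] by (metis image_subset_iff)
    moreover have *: "{l e, l (mu e)} \<inter> l ` D \<noteq> {}" "\<not> {l e, l (mu e)} \<subseteq> l ` D"
      using e(2,3) by (simp_all only: tree[OF e(1), symmetric] not_False_eq_True)
    ultimately have "e \<notin> D" "mu e \<notin> D" by auto
    moreover have "l e \<in> l ` D \<or> l (mu e) \<in> l ` D" using *(1) by auto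
    ultimately obtain d f
      where "d \<in> D" "f \<in> edges G - D" "l d = l f"
      using eG by (metis DiffI imageE)
    then show False using no by blast
  qed
  have "edges G \<noteq> {}" using \<open>card (edges G) \<ge> 3\<close> by auto
  obtain es where "distinct (es @ map mu es)" "set (es @ map mu es) = edges G"
    "successively (\<lambda>e f. l (mu e) = l f) es" "l (mu (last es)) = l (hd es)"
    by (rule closed_euler_trail[OF \<open>finite (edges G)\<close> \<open>edges G \<noteq> {}\<close> _ even conn]) (use mu in auto)
  then show ?thesis
    using hamiltonian_cycle_of_trail[OF \<open>card (edges G) \<ge> 3\<close> mu le] that by blast
qed

section \<open>Random choice of two disjoint edge sets\<close>

text \<open>These are the choices on one pair that put no element of \<open>p \<inter> K\<close>
  into T, respectively Q. If \<open>p \<inter> K\<close> has 0, 1, 2 elements, there are 4, 3, 2 of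
  the first kind and 4, 2, 2 of the second, against the bounds 4, 3, 9/4.\<close>

lemma card_choices_le:
  assumes "card p = 2"
  shows "real (card {s \<in> Pow p. \<forall>u \<in> p \<inter> K. s \<noteq> {u}}) \<le> 4 * (3/4) ^ card (p \<inter> K)"
    and "real (card {s \<in> Pow p. p \<inter> K \<noteq> {} \<longrightarrow> s \<noteq> {} \<and> s \<noteq> p}) \<le> 4 * (3/4) ^ card (p \<inter> K)"
proof -
  obtain a b where p: "p = {a, b}" "a \<noteq> b" using assms by (auto simp: card_2_iff)
  have Pow: "Pow p = {{}, {a}, {b}, {a, b}}" by (auto simp: p)
  consider "p \<inter> K = {}" | c where "c \<in> p" "p \<inter> K = {c}" | "p \<inter> K = p"
    using p by (cases "a \<in> K"; cases "b \<in> K") auto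
  then have "real (card {s \<in> Pow p. \<forall>u \<in> p \<inter> K. s \<noteq> {u}}) \<le> 4 * (3/4) ^ card (p \<inter> K)
    \<and> real (card {s \<in> Pow p. p \<inter> K \<noteq> {} \<longrightarrow> s \<noteq> {} \<and> s \<noteq> p}) \<le> 4 * (3/4) ^ card (p \<inter> K)"
  proof cases
    case 1
    then have "{s \<in> Pow p. \<forall>u \<in> p \<inter> K. s \<noteq> {u}} = Pow p"
      "{s \<in> Pow p. p \<inter> K \<noteq> {} \<longrightarrow> s \<noteq> {} \<and> s \<noteq> p} = Pow p" by auto
    then show ?thesis using assms 1 by (simp add: card_Pow card_ge_0_finite)
  next
    case (2 c)
    have "{s \<in> Pow p. \<forall>u \<in> p \<inter> K. s \<noteq> {u}} = Pow p - {{c}}"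
      "{s \<in> Pow p. p \<inter> K \<noteq> {} \<longrightarrow> s \<noteq> {} \<and> s \<noteq> p} = Pow p - {{}, p}"
      using 2 by auto
    moreover have "{c} \<in> Pow p" "p \<noteq> {}" using 2 by auto
    ultimately show ?thesis
      using assms 2 by (simp add: card_Pow card_ge_0_finite card_Diff_subset)
  next
    case 3
    have eq: "{s \<in> Pow p. \<forall>u \<in> p \<inter> K. s \<noteq> {u}} = {{}, p}"
      "{s \<in> Pow p. p \<inter> K \<noteq> {} \<longrightarrow> s \<noteq> {} \<and> s \<noteq> p} = {{a}, {b}}"
      unfolding Pow using 3 p by auto
    show ?thesis unfolding eq using assms 3 p(2) by (auto simp: card_insert_if power2_eq_square)
  qed
  then show "real (card {s \<in> Pow p. \<forall>u \<in> p \<inter> K. s \<noteq> {u}}) \<le> 4 * (3/4) ^ card (p \<inter> K)"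
    and "real (card {s \<in> Pow p. p \<inter> K \<noteq> {} \<longrightarrow> s \<noteq> {} \<and> s \<noteq> p}) \<le> 4 * (3/4) ^ card (p \<inter> K)"
    by auto
qed

text \<open>The pairs are chosen independently, so the bounds multiply; the exponents add up to
  \<open>card K\<close> because the pairs partition \<open>K\<close>.\<close>

lemma card_PiE_choices_le:
  assumes "finite M" and two: "\<And>p. p \<in> M \<Longrightarrow> card p = 2" and disj: "pairwise disjnt M"
    and K: "K \<subseteq> \<Union>M" and B: "\<And>p. p \<in> M \<Longrightarrow> real (card (B p)) \<le> 4 * (3/4) ^ card (p \<inter> K)"
  shows "real (card (Pi\<^sub>E M B)) \<le> 4 ^ card M * (3/4) ^ card K"
proof -
  have "card K = card (\<Union>p \<in> M. p \<inter> K)"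
    using K by (intro arg_cong[of _ _ card]) auto
  also have "\<dots> = (\<Sum>p \<in> M. card (p \<inter> K))"
  proof (intro card_UN_disjoint ballI impI)
    show "finite (p \<inter> K)" if "p \<in> M" for p
      using two[OF that] by (simp add: card_ge_0_finite)
    show "p \<inter> K \<inter> (q \<inter> K) = {}" if "p \<in> M" "q \<in> M" "p \<noteq> q" for p q
      using pairwiseD[OF disj that] by (auto simp: disjnt_def)
  qed (rule \<open>finite M\<close>)
  finally have K: "card K = (\<Sum>p \<in> M. card (p \<inter> K))" .
  have "real (card (Pi\<^sub>E M B)) = (\<Prod>p \<in> M. real (card (B p)))"
    using \<open>finite M\<close> by (simp add: card_PiE)
  also have "\<dots> \<le> (\<Prod>p \<in> M. 4 * (3/4) ^ card (p \<inter> K))"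
    using B by (intro prod_mono) auto
  also have "\<dots> = 4 ^ card M * (3/4) ^ card K"
    by (simp add: K prod.distrib power_sum)
  finally show ?thesis .
qed

text \<open>Choose a uniformly random subset of every pair: the chosen singletons form T, the pairs from
  which nothing or everything is chosen form Q. Each of T and Q misses K with probability at most
  (3/4)^|K|.\<close>

lemma random_split:
  fixes K :: "'i \<Rightarrow> 'a set"
  assumes "finite M" and two: "\<And>p. p \<in> M \<Longrightarrow> card p = 2" and disj: "pairwise disjnt M"
    and "finite I" and K: "\<And>i. i \<in> I \<Longrightarrow> K i \<subseteq> \<Union>M"
    and sum: "(\<Sum>i \<in> I. (3/4) ^ card (K i)) < (1/2 :: real)"
  obtains T Q where "T \<subseteq> \<Union>M" "Q \<subseteq> \<Union>M"
    "\<forall>p \<in> M. \<forall>u \<in> p \<inter> T. \<forall>v \<in> p. v \<notin> Q \<and> (v \<in> T \<longrightarrow> v = u)"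
    "\<forall>i \<in> I. T \<inter> K i \<noteq> {} \<and> Q \<inter> K i \<noteq> {}"
proof -
  \<comment> \<open>The bad events: under the choices in \<open>BT i\<close> the set T misses
    \<open>K i\<close>, under those in \<open>BQ i\<close> the set Q does. Two events for each
    \<open>i\<close> account for the 1/2 in the assumption on the sum.\<close>
  define BT where "BT i = Pi\<^sub>E M (\<lambda>p. {s \<in> Pow p. \<forall>u \<in> p \<inter> K i. s \<noteq> {u}})" for i
  define BQ where "BQ i = Pi\<^sub>E M (\<lambda>p. {s \<in> Pow p. p \<inter> K i \<noteq> {} \<longrightarrow> s \<noteq> {} \<and> s \<noteq> p})" for i
  have fin: "finite p" if "p \<in> M" for p using two[OF that] by (simp add: card_ge_0_finite)
  have finP: "finite (Pi\<^sub>E M B)" if "\<And>p. B p \<subseteq> Pow p" for B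
    using that fin \<open>finite M\<close> by (intro finite_PiE) (auto intro: finite_subset[OF that])
  have "real (card (\<Union>i \<in> I. BT i \<union> BQ i)) \<le> real (\<Sum>i \<in> I. card (BT i \<union> BQ i))"
    by (intro of_nat_mono card_UN_le \<open>finite I\<close>)
  also have "\<dots> = (\<Sum>i \<in> I. real (card (BT i \<union> BQ i)))" by (rule of_nat_sum)
  also have "\<dots> \<le> (\<Sum>i \<in> I. 4 ^ card M * (2 * (3/4) ^ card (K i)))"
  proof (intro sum_mono)
    fix i assume "i \<in> I"
    have "real (card (BT i \<union> BQ i)) \<le> real (card (BT i)) + real (card (BQ i))"
      using card_Un_le[of "BT i" "BQ i"] by linarith
    moreover have "real (card (BT i)) \<le> 4 ^ card M * (3/4) ^ card (K i)"
      unfolding BT_def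
      by (intro card_PiE_choices_le card_choices_le(1)) (use assms \<open>i \<in> I\<close> in auto)
    moreover have "real (card (BQ i)) \<le> 4 ^ card M * (3/4) ^ card (K i)"
      unfolding BQ_def
      by (intro card_PiE_choices_le card_choices_le(2)) (use assms \<open>i \<in> I\<close> in auto)
    ultimately show "real (card (BT i \<union> BQ i)) \<le> 4 ^ card M * (2 * (3/4) ^ card (K i))"
      by linarith
  qed
  also have "\<dots> = 4 ^ card M * (2 * (\<Sum>i \<in> I. (3/4) ^ card (K i)))"
    by (simp add: sum_distrib_left)
  also have "\<dots> < 4 ^ card M * 1"
    using sum by (intro mult_strict_left_mono) auto
  also have "\<dots> = real (card (Pi\<^sub>E M Pow))"
    using \<open>finite M\<close> fin two by (simp add: card_PiE card_Pow)
  finally have less: "card (\<Union>i \<in> I. BT i \<union> BQ i) < card (Pi\<^sub>E M Pow)"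
    by (simp only: of_nat_less_iff)
  have finU: "finite (\<Union>i \<in> I. BT i \<union> BQ i)"
    using \<open>finite I\<close> unfolding BT_def BQ_def by (intro finite_UN_I finite_UnI finP) auto
  have "\<not> Pi\<^sub>E M Pow \<subseteq> (\<Union>i \<in> I. BT i \<union> BQ i)"
    using card_mono[OF finU, of "Pi\<^sub>E M Pow"] less by linarith
  then obtain w where w: "w \<in> Pi\<^sub>E M Pow" "\<And>i. i \<in> I \<Longrightarrow> w \<notin> BT i" "\<And>i. i \<in> I \<Longrightarrow> w \<notin> BQ i"
    by blast
  define T where "T = {u. \<exists>p \<in> M. u \<in> p \<and> w p = {u}}"
  define Q where "Q = {u. \<exists>p \<in> M. u \<in> p \<and> (w p = {} \<or> w p = p)}"
  have uniq: "p = q" if "p \<in> M" "q \<in> M" "u \<in> p" "u \<in> q" for p q u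
    using pairwiseD[OF disj that(1,2)] that(3,4) by (auto simp: disjnt_def)
  show ?thesis
  proof (rule that[of T Q])
    show "T \<subseteq> \<Union>M" "Q \<subseteq> \<Union>M" by (auto simp: T_def Q_def)
    show "\<forall>i \<in> I. T \<inter> K i \<noteq> {} \<and> Q \<inter> K i \<noteq> {}"
    proof (intro ballI conjI)
      fix i assume i: "i \<in> I"
      have "\<exists>p \<in> M. \<exists>u \<in> p \<inter> K i. w p = {u}"
        using w(1) w(2)[OF i] by (auto simp: PiE_iff BT_def)
      then show "T \<inter> K i \<noteq> {}" by (auto simp: T_def)
      have "\<exists>p \<in> M. p \<inter> K i \<noteq> {} \<and> (w p = {} \<or> w p = p)"
        using w(1) w(3)[OF i] by (auto simp: PiE_iff BQ_def)
      then show "Q \<inter> K i \<noteq> {}" by (auto simp: Q_def)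
    qed
    show "\<forall>p \<in> M. \<forall>u \<in> p \<inter> T. \<forall>v \<in> p. v \<notin> Q \<and> (v \<in> T \<longrightarrow> v = u)"
    proof (intro ballI)
      fix p u v assume "p \<in> M" "u \<in> p \<inter> T" "v \<in> p"
      then have p: "p \<in> M" "u \<in> p" "v \<in> p" "u \<in> T" by auto
      have T: "x \<in> T \<longleftrightarrow> w p = {x}" and Q: "x \<in> Q \<longleftrightarrow> w p = {} \<or> w p = p" if "x \<in> p" for x
        using uniq[OF p(1)] p(1) that unfolding T_def Q_def by blast+
      have wp: "w p = {u}" using p T by blast
      moreover have "p \<noteq> {u}" using two[OF p(1)] by auto
      ultimately have "v \<notin> Q" using wp Q[OF p(3)] by auto
      moreover have "v = u" if "v \<in> T" using that wp T[OF p(3)] by auto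
      ultimately show "v \<notin> Q \<and> (v \<in> T \<longrightarrow> v = u)" by auto
    qed
  qed
qed

section \<open>Cuts of the complete bipartite graph and numerical estimates\<close>

text \<open>If \<open>X\<close> has a and b vertices in the two sides, its cut has 2k(a + b) - 2ab
  edges, and 2ab \<le> (a + b)^2 / 2 \<le> k(a + b).\<close>

lemma cut_complete_bipartite_ge:
  assumes X: "X \<subseteq> verts (complete_bipartite (2 * k) (2 * k))" and "card X \<le> 2 * k"
  shows "k * card X \<le> card (cut (edges (complete_bipartite (2 * k) (2 * k))) X)"
proof -
  define A where "A = {i. i < 2 * k \<and> Inl i \<in> X}"
  define B where "B = {i. i < 2 * k \<and> Inr i \<in> X}"
  let ?n = "{..<2 * k}"
  have AB: "A \<subseteq> ?n" "B \<subseteq> ?n" by (auto simp: A_def B_def)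
  then have fin: "finite A" "finite B" by (auto intro: finite_subset)
  have "X = Inl ` A \<union> Inr ` B" using X by (auto simp: A_def B_def complete_bipartite_def)
  then have X': "X = A <+> B" by (simp add: Plus_def)
  then have cardX: "card X = card A + card B" using fin by (simp add: card_Plus)
  let ?P = "A \<times> (?n - B) \<union> (?n - A) \<times> B"
  let ?f = "\<lambda>(i, j). {Inl i, Inr j} :: (nat + nat) set"
  have "card ?P = card (A \<times> (?n - B)) + card ((?n - A) \<times> B)"
    using fin by (intro card_Un_disjoint) auto
  also have "\<dots> = card A * (2 * k - card B) + (2 * k - card A) * card B"
    using fin AB by (simp add: card_cartesian_product card_Diff_subset)
  finally have P: "card ?P = card A * (2 * k - card B) + (2 * k - card A) * card B" .
  have "inj_on ?f ?P" by (auto simp: inj_on_def doubleton_eq_iff)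
  then have "card ?P = card (?f ` ?P)" by (simp add: card_image)
  also have "\<dots> \<le> card (cut (edges (complete_bipartite (2 * k) (2 * k))) X)"
  proof (rule card_mono)
    have "edges (complete_bipartite (2 * k) (2 * k)) = ?f ` (?n \<times> ?n)"
      by (auto simp: complete_bipartite_def)
    then show "finite (cut (edges (complete_bipartite (2 * k) (2 * k))) X)"
      by (simp add: cut_def)
    show "?f ` ?P \<subseteq> cut (edges (complete_bipartite (2 * k) (2 * k))) X"
      using AB by (auto simp: cut_def complete_bipartite_def X')
  qed
  finally have le: "card ?P \<le> card (cut (edges (complete_bipartite (2 * k) (2 * k))) X)" .
  define a b where "a = int (card A)" and "b = int (card B)"
  have ab: "a \<ge> 0" "b \<ge> 0" "a + b \<le> 2 * int k"
    using assms(2) cardX by (auto simp: a_def b_def)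
  \<comment> \<open>The right-hand side equals 2k(a + b) - 4ab, twice the difference of the two
    sides of the next inequality.\<close>
  have "0 \<le> (2 * int k - (a + b)) * (a + b) + (a - b)\<^sup>2" using ab by simp
  then have "int k * (a + b) \<le> a * (2 * int k - b) + (2 * int k - a) * b"
    by (simp add: algebra_simps power2_eq_square)
  moreover have "int (card ?P) = a * (2 * int k - b) + (2 * int k - a) * b"
    using ab unfolding P a_def b_def by (simp add: of_nat_diff)
  ultimately have "int (k * card X) \<le> int (card ?P)" by (simp add: cardX a_def b_def)
  then show ?thesis using le by linarith
qed

text \<open>The ratio of successive values is 3(k + 1)/(4k), at most 1 for k \<ge> 3, so the value
  at k = 25 decides. The assumption m \<ge> 50 enters the estimates here.\<close>

lemma four_mult_power_le:
  assumes "k \<ge> 25"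
  shows "4 * real k * (3/4) ^ k \<le> 1/10"
  using assms
proof (induction k rule: nat_induct_at_least)
  case base
  then show ?case by (simp add: power_divide)
next
  case (Suc n)
  have "real (Suc n) * 3 \<le> real n * 4" using Suc(1) by simp
  then have "real (Suc n) * 3 * (3/4) ^ n \<le> real n * 4 * (3/4) ^ n"
    by (intro mult_right_mono) auto
  moreover have "4 * real (Suc n) * (3/4) ^ Suc n = real (Suc n) * 3 * (3/4) ^ n" by simp
  ultimately show ?case using Suc.IH by linarith
qed

text \<open>With r = (3/4)^k the sum over all subsets of \<open>V\<close> is (1 + r)^(4k); the empty
  set contributes 1, so a bound below 3/2 is wanted.\<close>

lemma sum_power_card_less:
  assumes "k \<ge> 25" and "finite V" and "card V = 4 * k"
  shows "(\<Sum>X | X \<subseteq> V \<and> X \<noteq> {}. ((3/4) ^ k) ^ card X) < (1/2 :: real)"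
proof -
  define r :: real where "r = (3/4) ^ k"
  have r: "r \<ge> 0" "r \<le> 1" "real (4 * k) * r \<le> 1/10"
    using four_mult_power_le[OF assms(1)] by (auto simp: r_def power_le_one)
  have "(\<Sum>X \<in> Pow V. r ^ card X) = (\<Prod>x \<in> V. r + 1)"
    using prod_add[OF \<open>finite V\<close>, of "\<lambda>_. r" "\<lambda>_. 1"] by simp
  also have "\<dots> = (1 + r) ^ (4 * k)" using assms(3) by (simp add: add.commute)
  finally have sum: "(\<Sum>X \<in> Pow V. r ^ card X) = (1 + r) ^ (4 * k)" .
  \<comment> \<open>Bernoulli bounds (1 - r)^(4k) from below by 9/10; since (1 + r)(1 - r) \<le> 1,
    this gives (1 + r)^(4k) \<le> 10/9.\<close>
  have "9/10 \<le> 1 + real (4 * k) * (- r)" using r by simp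
  also have "\<dots> \<le> (1 + - r) ^ (4 * k)"
    using r by (intro Bernoulli_inequality) auto
  finally have "(1 + r) ^ (4 * k) * (9/10) \<le> (1 + r) ^ (4 * k) * (1 - r) ^ (4 * k)"
    using r by (intro mult_left_mono) auto
  also have "\<dots> = (1 - r * r) ^ (4 * k)"
    by (simp add: algebra_simps flip: power_mult_distrib)
  also have "\<dots> \<le> 1" using r by (intro power_le_one) (auto simp: mult_le_one)
  finally have "(1 + r) ^ (4 * k) < 3/2" by simp
  moreover have "{X. X \<subseteq> V \<and> X \<noteq> {}} = Pow V - {{}}" by auto
  ultimately show ?thesis
    using sum \<open>finite V\<close> by (simp add: sum_diff1 flip: r_def)
qed

section \<open>Application to the complete bipartite graph\<close>

theorem theorem5:
  fixes m :: nat
  assumes "even m" and "m \<ge> 50"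
  shows "PMH_property (line_graph (complete_bipartite m m))"
  unfolding PMH_property_def
proof (intro allI impI)
  let ?G = "complete_bipartite m m"
  fix M assume M: "perfect_matching (line_graph ?G) M"
  obtain k where m: "m = 2 * k" and k: "k \<ge> 25" using assms by (auto elim!: evenE)
  have G: "simple_graph ?G" by (rule simple_graph_complete_bipartite)
  have edge: "e \<subseteq> verts ?G" if "e \<in> edges ?G" for e
    using G that by (simp add: simple_graph_def)
  have "verts ?G = {..<m} <+> {..<m}" by (simp add: complete_bipartite_def Plus_def)
  then have V: "finite (verts ?G)" "card (verts ?G) = 4 * k" by (simp_all add: card_Plus m)
  have "edges ?G = (\<lambda>(i, j). {Inl i, Inr j}) ` ({..<m} \<times> {..<m})"
    by (auto simp: complete_bipartite_def)
  moreover have "inj_on (\<lambda>(i, j). {Inl i, Inr j} :: (nat + nat) set) ({..<m} \<times> {..<m})"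
    by (auto simp: inj_on_def doubleton_eq_iff)
  ultimately have E: "finite (edges ?G)" "card (edges ?G) = m * m"
    by (simp_all add: card_image card_cartesian_product)
  obtain mu where mu_all: "\<forall>e \<in> edges ?G.
      mu e \<in> edges ?G \<and> mu e \<noteq> e \<and> mu (mu e) = e \<and> e \<inter> mu e \<noteq> {}"
    and M_mu: "M = (\<lambda>e. {e, mu e}) ` edges ?G"
    using perfect_matching_partner[OF G M] by blast
  note mu = bspec[OF mu_all]
  have UM: "\<Union>M = edges ?G" using mu by (auto simp: M_mu)
  \<comment> \<open>The lower bound on cuts holds up to size \<open>m\<close>, half of all vertices.
    Larger sets are reached through their complements.\<close>
  define I where "I = {X. X \<subseteq> verts ?G \<and> X \<noteq> {} \<and> card X \<le> m}"
  have I: "I \<subseteq> {X. X \<subseteq> verts ?G \<and> X \<noteq> {}}" by (auto simp: I_def)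
  have fin: "finite {X. X \<subseteq> verts ?G \<and> X \<noteq> {}}" using V(1) by simp
  have "(\<Sum>X \<in> I. (3/4) ^ card (cut (edges ?G) X)) \<le> (\<Sum>X \<in> I. ((3/4) ^ k) ^ card X :: real)"
  proof (intro sum_mono)
    fix X assume "X \<in> I"
    then have "k * card X \<le> card (cut (edges ?G) X)"
      using cut_complete_bipartite_ge[of X k] by (simp add: I_def m)
    then show "(3/4) ^ card (cut (edges ?G) X) \<le> (((3/4) ^ k) ^ card X :: real)"
      by (simp add: power_decreasing flip: power_mult)
  qed
  \<comment> \<open>Enlarging the index set to all nonempty subsets makes the sum a product.\<close>
  also have "\<dots> \<le> (\<Sum>X | X \<subseteq> verts ?G \<and> X \<noteq> {}. ((3/4) ^ k) ^ card X)"
    using I fin by (intro sum_mono2) auto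
  also have "\<dots> < 1/2" by (rule sum_power_card_less[OF k V])
  finally have sum: "(\<Sum>X \<in> I. (3/4) ^ card (cut (edges ?G) X)) < (1/2 :: real)" .
  have disj: "pairwise disjnt M"
  proof (rule pairwiseI)
    fix p q assume "p \<in> M" "q \<in> M" "p \<noteq> q"
    then obtain e f where ef: "e \<in> edges ?G" "f \<in> edges ?G" "p = {e, mu e}" "q = {f, mu f}"
      by (auto simp: M_mu)
    show "disjnt p q"
    proof (rule ccontr)
      assume "\<not> disjnt p q"
      then have "e = f \<or> e = mu f \<or> mu e = f \<or> mu e = mu f"
        unfolding ef(3,4) disjnt_def by blast
      then have "e = f \<or> e = mu f \<and> mu e = f" using mu[OF ef(1)] mu[OF ef(2)] by metis
      then show False using \<open>p \<noteq> q\<close> unfolding ef(3,4) by auto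
    qed
  qed
  have two: "card p = 2" if p: "p \<in> M" for p
  proof -
    obtain e where "e \<in> edges ?G" "p = {e, mu e}" using p by (auto simp: M_mu)
    then show ?thesis using mu[of e] by (metis card_2_iff)
  qed
  have finM: "finite M" using E by (simp add: M_mu)
  have finI: "finite I" using I fin by (rule finite_subset)
  have sub: "cut (edges ?G) X \<subseteq> \<Union>M" for X unfolding UM by (auto simp: cut_def)
  obtain T Q where TQ: "T \<subseteq> \<Union>M" "Q \<subseteq> \<Union>M"
    "\<forall>p \<in> M. \<forall>u \<in> p \<inter> T. \<forall>v \<in> p. v \<notin> Q \<and> (v \<in> T \<longrightarrow> v = u)"
    "\<forall>X \<in> I. T \<inter> cut (edges ?G) X \<noteq> {} \<and> Q \<inter> cut (edges ?G) X \<noteq> {}"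
    by (rule random_split[OF finM two disj finI sub sum])
  note sub = TQ(1,2)[unfolded UM]
  have conn: "cut_connected (verts ?G) S"
    if S: "S \<subseteq> edges ?G" and meets: "\<And>X. X \<in> I \<Longrightarrow> S \<inter> cut (edges ?G) X \<noteq> {}" for S
    unfolding cut_connected_def
  proof (intro allI impI)
    fix X assume X: "X \<subseteq> verts ?G" "X \<noteq> {}" "X \<noteq> verts ?G"
    have cut: "S \<inter> cut (edges ?G) Y = cut S Y" for Y using S by (auto simp: cut_def)
    show "cut S X \<noteq> {}"
    proof (cases "card X \<le> m")
      case True
      then show ?thesis using meets[of X] X cut by (simp add: I_def)
    next
      case False
      \<comment> \<open>The complement has fewer than \<open>m\<close> vertices, and an edge leaving
        it also leaves \<open>X\<close>.\<close>
      have "card (verts ?G - X) = 4 * k - card X"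
        using V X(1) by (simp add: card_Diff_subset finite_subset)
      then have "verts ?G - X \<in> I" using False X m by (auto simp: I_def)
      then have "cut S (verts ?G - X) \<noteq> {}" using meets cut by metis
      moreover have "cut S (verts ?G - X) \<subseteq> cut S X" using S edge by (fastforce simp: cut_def)
      ultimately show ?thesis by auto
    qed
  qed
  have TQ_disj: "T \<inter> mu ` T = {}" "Q \<inter> (T \<union> mu ` T) = {}"
  proof -
    have "mu e \<notin> T \<and> mu e \<notin> Q \<and> e \<notin> Q" if "e \<in> T" for e
    proof -
      have e: "e \<in> edges ?G" using that sub(1) by blast
      then have "{e, mu e} \<in> M" unfolding M_mu by (rule imageI)
      have "mu e \<noteq> e" using mu[OF e] by blast
      have "\<forall>v \<in> {e, mu e}. v \<notin> Q \<and> (v \<in> T \<longrightarrow> v = e)"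
        using bspec[OF TQ(3) \<open>{e, mu e} \<in> M\<close>] that by simp
      then show ?thesis using \<open>mu e \<noteq> e\<close> by simp
    qed
    then show "T \<inter> mu ` T = {}" "Q \<inter> (T \<union> mu ` T) = {}" by auto
  qed
  have "even (card (edges ?G))" "card (edges ?G) \<ge> 3"
    using E(2) assms mult_le_mono[OF assms(2) assms(2)] by auto
  then obtain vs where "hamiltonian_cycle (line_graph ?G) vs"
      "(\<lambda>e. {e, mu e}) ` edges ?G \<subseteq> cycle_edges vs"
    by (rule hamiltonian_cycle_of_connected_pair[OF G _ _ mu sub(1) TQ_disj(1) conn[OF sub(1)]
        sub(2) TQ_disj(2) conn[OF sub(2)]]) (use TQ(4) in auto)
  then show "\<exists>vs. hamiltonian_cycle (line_graph ?G) vs \<and> M \<subseteq> cycle_edges vs"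
    unfolding M_mu by blast
qed

end
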